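(* Let $V$ be a right quaternionic Hilbert space and $A\in\mathcal B(V)$. Then: (a) $\sigma_{pS}(A)\subseteq\sigma_c^S(A^\dagger)$ and $\sigma_c^S(A)=\sigma_{pS}(A^\dagger)$; (b) $\sigma_{su}^S(A)=\sigma_{ap}^S(A^\dagger)$ and $\sigma_{ap}^S(A)=\sigma_{su}^S(A^\dagger)$; (c) $\sigma_S(A)=\sigma_S(A^\dagger)$.
   Context: $\mathbb H$ denotes the quaternions. A right quaternionic Hilbert space $V$ is a right $\mathbb H$-vector space with an $\mathbb H$-valued inner product satisfying $\overline{\langle\phi|\psi\rangle}=\langle\psi|\phi\rangle$, additivity, $\langle\phi|\psi\mathfrak q\rangle=\langle\phi|\psi\rangle\mathfrak q$, $\langle\phi\mathfrak q|\psi\rangle=\overline{\mathfrak q}\langle\phi|\psi\rangle$ and $\|\phi\|^2=\langle\phi|\phi\rangle>0$ for $\phi\ne0$, complete in this norm and separable. $\mathcal B(V)$ is the set of bounded right $\mathbb H$-linear operators $V\to V$; $A^\dagger$ is the adjoint, $\langle\psi|A\phi\rangle=\langle A^\dagger\psi|\phi\rangle$. For $\mathfrak q\in\mathbb H$, $R_{\mathfrak q}(A)=A^2-2\,\mathrm{Re}(\mathfrak q)A+|\mathfrak q|^2 I$. $\sigma_S(A)=\{\mathfrak q\in\mathbb H: R_{\mathfrak q}(A)\text{ has no inverse in }\mathcal B(V)\}$ (S-spectrum); $\sigma_{pS}(A)=\{\mathfrak q:\ker R_{\mathfrak q}(A)\neq\{0\}\}$ (spherical point spectrum); $\sigma_c^S(A)=\{\mathfrak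 q:\mathrm{ran}(R_{\mathfrak q}(A))\text{ is not dense in }V\}$ (spherical compression spectrum); $\sigma_{ap}^S(A)=\{\mathfrak q:\exists\,(\phi_n),\ \|\phi_n\|=1,\ \|R_{\mathfrak q}(A)\phi_n\|\to0\}$ (approximate S-point spectrum); $\sigma_{su}^S(A)=\{\mathfrak q:\mathrm{ran}(R_{\mathfrak q}(A))\ne V\}$ (surjectivity S-spectrum). *)

theory Defs
  imports "HOL-Analysis.Analysis"
begin

section \<open>Quaternions\<close>

text \<open>\<^term>\<open>Quat a b c d\<close> stands for $a + b i + c j + d k$.\<close>

codatatype quat = Quat (QRe: real) (QIm1: real) (QIm2: real) (QIm3: real)

lemma quat_eq_iff:
  "x = y \<longleftrightarrow> QRe x = QRe y \<and> QIm1 x = QIm1 y \<and> QIm2 x = QIm2 y \<and> QIm3 x = QIm3 y"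
  by (auto intro: quat.expand)

instantiation quat :: ab_group_add
begin

primcorec zero_quat where
  "QRe 0 = 0" | "QIm1 0 = 0" | "QIm2 0 = 0" | "QIm3 0 = 0"

primcorec plus_quat where
  "QRe (x + y) = QRe x + QRe y"
| "QIm1 (x + y) = QIm1 x + QIm1 y"
| "QIm2 (x + y) = QIm2 x + QIm2 y"
| "QIm3 (x + y) = QIm3 x + QIm3 y"

primcorec uminus_quat where
  "QRe (- x) = - QRe x"
| "QIm1 (- x) = - QIm1 x"
| "QIm2 (- x) = - QIm2 x"
| "QIm3 (- x) = - QIm3 x"

primcorec minus_quat where
  "QRe (x - y) = QRe x - QRe y"
| "QIm1 (x - y) = QIm1 x - QIm1 y"
| "QIm2 (x - y) = QIm2 x - QIm2 y"
| "QIm3 (x - y) = QIm3 x - QIm3 y"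

instance
  by standard (simp_all add: quat_eq_iff)

end

instantiation quat :: ring_1
begin

primcorec one_quat where
  "QRe 1 = 1" | "QIm1 1 = 0" | "QIm2 1 = 0" | "QIm3 1 = 0"

primcorec times_quat where
  "QRe (x * y) = QRe x * QRe y - QIm1 x * QIm1 y - QIm2 x * QIm2 y - QIm3 x * QIm3 y"
| "QIm1 (x * y) = QRe x * QIm1 y + QIm1 x * QRe y + QIm2 x * QIm3 y - QIm3 x * QIm2 y"
| "QIm2 (x * y) = QRe x * QIm2 y - QIm1 x * QIm3 y + QIm2 x * QRe y + QIm3 x * QIm1 y"
| "QIm3 (x * y) = QRe x * QIm3 y + QIm1 x * QIm2 y - QIm2 x * QIm1 y + QIm3 x * QRe y"

instance
  by standard (simp_all add: quat_eq_iff algebra_simps)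

end

instantiation quat :: real_algebra_1
begin

primcorec scaleR_quat where
  "QRe (scaleR r x) = r * QRe x"
| "QIm1 (scaleR r x) = r * QIm1 x"
| "QIm2 (scaleR r x) = r * QIm2 x"
| "QIm3 (scaleR r x) = r * QIm3 x"

instance
  by standard (simp_all add: quat_eq_iff algebra_simps)

end

instantiation quat :: real_inner
begin

definition inner_quat :: "quat \<Rightarrow> quat \<Rightarrow> real" where
  "inner x y = QRe x * QRe y + QIm1 x * QIm1 y + QIm2 x * QIm2 y + QIm3 x * QIm3 y"

definition norm_quat :: "quat \<Rightarrow> real" where
  "norm x = sqrt ((QRe x)\<^sup>2 + (QIm1 x)\<^sup>2 + (QIm2 x)\<^sup>2 + (QIm3 x)\<^sup>2)"

definition sgn_quat :: "quat \<Rightarrow> quat" where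
  "sgn x = x /\<^sub>R norm x" for x :: quat

definition dist_quat :: "quat \<Rightarrow> quat \<Rightarrow> real" where
  "dist x y = norm (x - y)" for x y :: quat

definition uniformity_quat :: "(quat \<times> quat) filter" where
  "uniformity = (INF e\<in>{0 <..}. principal {(x :: quat, y). dist x y < e})"

definition open_quat :: "quat set \<Rightarrow> bool" where
  "open U \<longleftrightarrow> (\<forall>x\<in>U. eventually (\<lambda>(x' :: quat, y). x' = x \<longrightarrow> y \<in> U) uniformity)"

instance
proof
  fix x y z :: quat and r :: real
  show "inner x y = inner y x"
    by (simp add: inner_quat_def mult.commute)
  show "inner (x + y) z = inner x z + inner y z"
    by (simp add: inner_quat_def distrib_right)
  show "inner (scaleR r x) y = r * inner x y"
    by (simp add: inner_quat_def distrib_left)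
  show "0 \<le> inner x x"
    by (simp add: inner_quat_def)
  show "inner x x = 0 \<longleftrightarrow> x = 0"
    by (simp add: inner_quat_def quat_eq_iff add_nonneg_eq_0_iff)
  show "norm x = sqrt (inner x x)"
    by (simp add: inner_quat_def norm_quat_def power2_eq_square)
  show "sgn x = x /\<^sub>R norm x"
    by (rule sgn_quat_def)
  show "dist x y = norm (x - y)"
    by (rule dist_quat_def)
  show "(uniformity :: (quat \<times> quat) filter) =
      (INF e\<in>{0 <..}. principal {(x, y). dist x y < e})"
    by (rule uniformity_quat_def)
  show "open U \<longleftrightarrow> (\<forall>x\<in>U. eventually (\<lambda>(x', y). x' = x \<longrightarrow> y \<in> U) uniformity)"
    for U :: "quat set"
    by (rule open_quat_def)
qed

end

instantiation quat :: euclidean_space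
begin

definition Basis_quat :: "quat set" where
  "Basis = {Quat 1 0 0 0, Quat 0 1 0 0, Quat 0 0 1 0, Quat 0 0 0 1}"

instance
proof
  fix u v x :: quat
  show "(Basis :: quat set) \<noteq> {}" "finite (Basis :: quat set)"
    by (simp_all add: Basis_quat_def)
  show "inner u v = (if u = v then 1 else 0)" if "u \<in> Basis" "v \<in> Basis"
    using that unfolding Basis_quat_def by (elim insertE emptyE) (simp_all add: inner_quat_def)
  show "(\<forall>u\<in>Basis. inner x u = 0) \<longleftrightarrow> x = 0"
    unfolding quat_eq_iff[of x] by (simp add: Basis_quat_def inner_quat_def)
qed

end

primcorec qcnj :: "quat \<Rightarrow> quat" where
  "QRe (qcnj x) = QRe x"
| "QIm1 (qcnj x) = - QIm1 x"
| "QIm2 (qcnj x) = - QIm2 x"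
| "QIm3 (qcnj x) = - QIm3 x"

lemma norm_quat_power2:
  "(norm x)\<^sup>2 = (QRe x)\<^sup>2 + (QIm1 x)\<^sup>2 + (QIm2 x)\<^sup>2 + (QIm3 x)\<^sup>2" for x :: quat
  by (simp add: norm_quat_def)

lemma qcnj_mult_self: "qcnj x * x = of_real ((norm x)\<^sup>2)"
  unfolding norm_quat_power2
  by (simp add: of_real_def quat_eq_iff power2_eq_square algebra_simps)

lemma mult_qcnj_self: "x * qcnj x = of_real ((norm x)\<^sup>2)"
  unfolding norm_quat_power2
  by (simp add: of_real_def quat_eq_iff power2_eq_square algebra_simps)

instantiation quat :: real_normed_div_algebra
begin

definition inverse_quat :: "quat \<Rightarrow> quat" where
  "inverse x = qcnj x /\<^sub>R (norm x)\<^sup>2"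

definition divide_quat :: "quat \<Rightarrow> quat \<Rightarrow> quat" where
  "x div y = x * inverse y" for x y :: quat

instance
proof
  fix x y :: quat
  show "x \<noteq> 0 \<Longrightarrow> inverse x * x = 1" "x \<noteq> 0 \<Longrightarrow> x * inverse x = 1"
    by (simp_all add: inverse_quat_def qcnj_mult_self mult_qcnj_self of_real_def)
  show "x div y = x * inverse y" "inverse (0::quat) = 0"
    by (simp_all add: divide_quat_def inverse_quat_def)
  have "(norm (x * y))\<^sup>2 = (norm x * norm y)\<^sup>2"
    unfolding power_mult_distrib norm_quat_power2 times_quat.sel
    by (simp add: power2_eq_square algebra_simps)
  then show "norm (x * y) = norm x * norm y"
    by (rule power2_eq_imp_eq) simp_all
qed

end

section \<open>Right quaternionic Hilbert spaces\<close>

text \<open>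
  The real vector space structure and the norm are those induced by the quaternionic scalar
  multiplication and the inner product (axioms \<open>scaleQ_of_real\<close> and \<open>qinner_self\<close>).
  Completeness is part of class \<^class>\<open>banach\<close>; positivity of \<open>qinner\<close> follows from
  \<open>qinner_self\<close> and positivity of the norm.
\<close>

class right_quat_hilbert = banach +
  fixes scaleQ :: "'a \<Rightarrow> quat \<Rightarrow> 'a" (infixl \<open>*\<^sub>Q\<close> 75)
    and qinner :: "'a \<Rightarrow> 'a \<Rightarrow> quat"
  assumes scaleQ_add_left: "(x + y) *\<^sub>Q p = x *\<^sub>Q p + y *\<^sub>Q p"
    and scaleQ_add_right: "x *\<^sub>Q (p + q) = x *\<^sub>Q p + x *\<^sub>Q q"
    and scaleQ_scaleQ: "(x *\<^sub>Q p) *\<^sub>Q q = x *\<^sub>Q (p * q)"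
    and scaleQ_one: "x *\<^sub>Q 1 = x"
    and scaleQ_of_real: "x *\<^sub>Q of_real r = scaleR r x"
    and qcnj_qinner: "qcnj (qinner x y) = qinner y x"
    and qinner_add_right: "qinner x (y + z) = qinner x y + qinner x z"
    and qinner_scaleQ_right: "qinner x (y *\<^sub>Q q) = qinner x y * q"
    and qinner_scaleQ_left: "qinner (x *\<^sub>Q q) y = qcnj q * qinner x y"
    and qinner_self: "qinner x x = of_real ((norm x)\<^sup>2)"
    and countable_dense: "\<exists>D. countable D \<and> (\<forall>x. \<forall>e>0. \<exists>d\<in>D. dist d x < e)"

instantiation quat :: right_quat_hilbert
begin

definition scaleQ_quat :: "quat \<Rightarrow> quat \<Rightarrow> quat" where
  "scaleQ_quat x q = x * q"

definition qinner_quat :: "quat \<Rightarrow> quat \<Rightarrow> quat" where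
  "qinner_quat x y = qcnj x * y"

instance
proof
  show "\<exists>D::quat set. countable D \<and> (\<forall>x. \<forall>e>0. \<exists>d\<in>D. dist d x < e)"
  proof -
    obtain D :: "quat set" where D: "countable D" "UNIV \<subseteq> closure D"
      using separable[of "UNIV :: quat set"] by auto
    then have "x \<in> closure D" for x
      by blast
    then show ?thesis
      using D(1) unfolding closure_approachable by blast
  qed
next
  fix x y z p q :: quat and r :: real
  show "(x + y) *\<^sub>Q p = x *\<^sub>Q p + y *\<^sub>Q p" "x *\<^sub>Q (p + q) = x *\<^sub>Q p + x *\<^sub>Q q"
       "(x *\<^sub>Q p) *\<^sub>Q q = x *\<^sub>Q (p * q)" "x *\<^sub>Q 1 = x" "x *\<^sub>Q of_real r = scaleR r x"
       "qinner x (y + z) = qinner x y + qinner x z" "qinner x (y *\<^sub>Q q) = qinner x y * q"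
    by (simp_all add: scaleQ_quat_def qinner_quat_def distrib_left distrib_right mult.assoc
        of_real_def)
  show "qinner x x = of_real ((norm x)\<^sup>2)"
    by (simp only: qinner_quat_def qcnj_mult_self)
  show "qcnj (qinner x y) = qinner y x" "qinner (x *\<^sub>Q q) y = qcnj q * qinner x y"
    by (simp_all add: scaleQ_quat_def qinner_quat_def quat_eq_iff algebra_simps)
qed

end

section \<open>Bounded operators and S-spectra\<close>

definition bounded_ops :: "('v::right_quat_hilbert \<Rightarrow> 'v) set" where
  "bounded_ops = {A. bounded_linear A \<and> (\<forall>x q. A (x *\<^sub>Q q) = A x *\<^sub>Q q)}"

definition qadjoint :: "('v::right_quat_hilbert \<Rightarrow> 'v) \<Rightarrow> ('v \<Rightarrow> 'v)" where
  "qadjoint A = (THE B. B \<in> bounded_ops \<and> (\<forall>\<psi> \<phi>. qinner \<psi> (A \<phi>) = qinner (B \<psi>) \<phi>))"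

definition R_op :: "quat \<Rightarrow> ('v::right_quat_hilbert \<Rightarrow> 'v) \<Rightarrow> ('v \<Rightarrow> 'v)" where
  "R_op q A = (\<lambda>\<phi>. A (A \<phi>) - (2 * QRe q) *\<^sub>R A \<phi> + (norm q)\<^sup>2 *\<^sub>R \<phi>)"

definition S_spectrum :: "('v::right_quat_hilbert \<Rightarrow> 'v) \<Rightarrow> quat set" where
  "S_spectrum A = {q. \<not> (\<exists>B\<in>bounded_ops. B \<circ> R_op q A = id \<and> R_op q A \<circ> B = id)}"

definition S_point_spectrum :: "('v::right_quat_hilbert \<Rightarrow> 'v) \<Rightarrow> quat set" where
  "S_point_spectrum A = {q. {\<phi>. R_op q A \<phi> = 0} \<noteq> {0}}"

definition S_compression_spectrum :: "('v::right_quat_hilbert \<Rightarrow> 'v) \<Rightarrow> quat set" where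
  "S_compression_spectrum A = {q. closure (range (R_op q A)) \<noteq> UNIV}"

definition S_approx_spectrum :: "('v::right_quat_hilbert \<Rightarrow> 'v) \<Rightarrow> quat set" where
  "S_approx_spectrum A =
     {q. \<exists>\<phi>::nat \<Rightarrow> 'v. (\<forall>n. norm (\<phi> n) = 1) \<and> (\<lambda>n. norm (R_op q A (\<phi> n))) \<longlonglongrightarrow> 0}"

definition S_surjectivity_spectrum :: "('v::right_quat_hilbert \<Rightarrow> 'v) \<Rightarrow> quat set" where
  "S_surjectivity_spectrum A = {q. range (R_op q A) \<noteq> UNIV}"

end

theory Submission
  imports Defs
begin

text \<open>
  For a bounded operator \<open>T\<close> on a Hilbert space with adjoint \<open>T\<^sup>*\<close> three dualities hold:
  \<open>T\<^sup>*\<close> is injective iff the range of \<open>T\<close> is dense, \<open>T\<close> is onto iff \<open>T\<^sup>*\<close> is bounded below, and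
  \<open>T\<close> is invertible iff \<open>T\<^sup>*\<close> is. An operator fails to be bounded below exactly when it nearly
  annihilates a sequence of unit vectors. Since the coefficients \<open>2 Re q\<close> and \<open>|q|\<^sup>2\<close> are real, taking
  the adjoint maps \<open>R\<^sub>q(A)\<close> to \<open>R\<^sub>q(A\<^sup>*)\<close>. Hence the dualities for \<open>T = R\<^sub>q(A)\<close> are precisely the
  equalities between spectra of \<open>A\<close> and of \<open>A\<^sup>*\<close>, and those in which the roles of \<open>A\<close> and \<open>A\<^sup>*\<close> are
  exchanged follow from \<open>A\<^sup>*\<^sup>* = A\<close>.

  The quaternions hardly enter the analysis. The real part of the quaternionic inner product
  is a real inner product with the same norm, and for right linear operators an identity between
  real parts upgrades to an identity between quaternionic inner products
  (\<open>qinner_adjointI\<close>). The existence statements all come from one variational principle,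
  \<open>symmetric_Lax_Milgram_on_subspace\<close>, applied to different forms and subspaces: it gives Riesz
  representation and hence the adjoint, orthogonal projection onto the closure of a range, and,
  with the form \<open>\<langle>Tx, Ty\<rangle>\<close>, the surjectivity of \<open>T\<^sup>*\<close> when \<open>T\<close> is bounded below. The converse, that
  the adjoint of a surjection is bounded below, is a consequence of the uniform boundedness
  principle.
\<close>

section \<open>Variational and uniform boundedness principles\<close>

text \<open>
  The solution minimises the energy \<open>J x = b x x - 2 f x\<close> over \<open>S\<close>. Coercivity bounds \<open>J\<close> from below,
  the parallelogram law turns a minimising sequence into a Cauchy sequence, and the
  vanishing of the first variation of \<open>J\<close> at its limit is the asserted equation.
\<close>

theorem symmetric_Lax_Milgram_on_subspace:
  fixes b :: "'a::banach \<Rightarrow> 'a \<Rightarrow> real" and f :: "'a \<Rightarrow> real"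
  assumes bil: "bounded_bilinear b"
    and sym: "\<And>x y. b x y = b y x"
    and "c > 0" and coercive: "\<And>x. c * (norm x)\<^sup>2 \<le> b x x"
    and f: "bounded_linear f"
    and S: "subspace S" "closed S"
  shows "\<exists>z\<in>S. \<forall>x\<in>S. b z x = f x"
proof -
  interpret b: bounded_bilinear b by fact
  interpret f: bounded_linear f by fact
  define J where "J x = b x x - 2 * f x" for x
  have J_lower: "J x \<ge> - (onorm f)\<^sup>2 / c" for x
  proof -
    have "f x \<le> onorm f * norm x"
      using onorm[OF f, of x] by simp
    then have "J x \<ge> c * (norm x)\<^sup>2 - 2 * (onorm f * norm x)"
      using coercive[of x] by (simp add: J_def)
    moreover have "c * (norm x)\<^sup>2 - 2 * (onorm f * norm x) + (onorm f)\<^sup>2 / c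
        = (c * norm x - onorm f)\<^sup>2 / c"
      using \<open>c > 0\<close> by (simp add: field_simps power2_eq_square)
    moreover have "(c * norm x - onorm f)\<^sup>2 / c \<ge> 0"
      using \<open>c > 0\<close> by simp
    ultimately show ?thesis by linarith
  qed
  define m where "m = Inf (J ` S)"
  have bdd: "bdd_below (J ` S)"
    using J_lower by (intro bdd_belowI2)
  have m_le: "m \<le> J x" if "x \<in> S" for x
    unfolding m_def using bdd that by (rule cINF_lower)
  have "\<exists>x\<in>S. J x < m + inverse (real (Suc n))" for n
  proof -
    have "J ` S \<noteq> {}" using subspace_0[OF S(1)] by auto
    moreover have "Inf (J ` S) < m + inverse (real (Suc n))"
      by (simp add: m_def)
    ultimately obtain r where "r \<in> J ` S" "r < m + inverse (real (Suc n))"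
      by (rule cInf_lessD[THEN bexE])
    then show ?thesis by auto
  qed
  then obtain X where X: "\<And>n. X n \<in> S" "\<And>n. J (X n) < m + inverse (real (Suc n))"
    by metis
  \<comment> \<open>The linear terms cancel because \<open>f\<close> is evaluated at the midpoint.\<close>
  have parallelogram: "b (x - y) (x - y) = 2 * J x + 2 * J y - 4 * J ((1/2) *\<^sub>R (x + y))" for x y
    by (simp add: J_def b.diff_left b.diff_right b.add_left b.add_right b.scaleR_left
        b.scaleR_right f.add f.scale sym[of y x] algebra_simps)
  have gap: "c * (norm (X n - X k))\<^sup>2 \<le> 2 * inverse (real (Suc n)) + 2 * inverse (real (Suc k))"
    for n k
  proof -
    have "(1/2) *\<^sub>R (X n + X k) \<in> S"
      using X(1) S(1) by (simp add: subspace_add subspace_scale)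
    from m_le[OF this] show ?thesis
      using coercive[of "X n - X k"] X(2)[of n] X(2)[of k] parallelogram[of "X n" "X k"] by linarith
  qed
  have "Cauchy X"
  proof (rule metric_CauchyI)
    fix e :: real assume "e > 0"
    then have "c * e\<^sup>2 / 4 > 0" using \<open>c > 0\<close> by simp
    then obtain N where N: "inverse (real (Suc N)) < c * e\<^sup>2 / 4"
      using reals_Archimedean by blast
    have "dist (X n) (X k) < e" if "n \<ge> N" "k \<ge> N" for n k
    proof -
      have "inverse (real (Suc n)) \<le> inverse (real (Suc N))"
           "inverse (real (Suc k)) \<le> inverse (real (Suc N))"
        using that by (auto intro: le_imp_inverse_le)
      then have "c * (norm (X n - X k))\<^sup>2 < c * e\<^sup>2"
        using gap[of n k] N by linarith
      then have "(norm (X n - X k))\<^sup>2 < e\<^sup>2" using \<open>c > 0\<close> by simp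
      then show ?thesis
        using \<open>e > 0\<close> by (simp add: dist_norm power_less_imp_less_base)
    qed
    then show "\<exists>M. \<forall>n\<ge>M. \<forall>k\<ge>M. dist (X n) (X k) < e" by blast
  qed
  then obtain z where z: "X \<longlonglongrightarrow> z"
    using Cauchy_convergent convergent_def by blast
  have "z \<in> S"
    using S(2) X(1) z closed_sequentially by blast
  have "(\<lambda>n. J (X n)) \<longlonglongrightarrow> J z"
    unfolding J_def by (intro tendsto_intros b.tendsto f.tendsto z)
  moreover have "(\<lambda>n. m + inverse (real (Suc n))) \<longlonglongrightarrow> m"
    using tendsto_add[OF tendsto_const LIMSEQ_inverse_real_of_nat] by simp
  ultimately have "J z \<le> m"
    by (rule LIMSEQ_le) (use X(2) less_imp_le in blast)
  have "b z x = f x" if "x \<in> S" for x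
  proof (rule ccontr)
    assume ne: "b z x \<noteq> f x"
    define d where "d = b z x - f x"
    have quad: "2 * t * d + t\<^sup>2 * b x x \<ge> 0" for t
    proof -
      have "z + t *\<^sub>R x \<in> S"
        using S(1) \<open>z \<in> S\<close> that by (simp add: subspace_add subspace_scale)
      then have "J z \<le> J (z + t *\<^sub>R x)"
        using m_le \<open>J z \<le> m\<close> by force
      then show ?thesis
        by (simp add: J_def d_def b.add_left b.add_right b.scaleR_left b.scaleR_right f.add
            f.scale sym[of x z] algebra_simps power2_eq_square)
    qed
    have "x \<noteq> 0" using ne by (auto simp: b.zero_right f.zero)
    then have "b x x > 0"
      using coercive[of x] \<open>c > 0\<close>
      by (smt (verit) mult_pos_pos zero_less_norm_iff zero_less_power)
    \<comment> \<open>The parabola is minimal, and strictly negative, at this \<open>t\<close>.\<close>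
    then have "2 * (- d / b x x) * d + (- d / b x x)\<^sup>2 * b x x = - (d\<^sup>2 / b x x)"
      by (simp add: field_simps power2_eq_square)
    moreover have "d\<^sup>2 / b x x > 0"
      using \<open>b x x > 0\<close> ne by (simp add: d_def)
    ultimately show False using quad[of "- d / b x x"] by linarith
  qed
  with \<open>z \<in> S\<close> show ?thesis by blast
qed

text \<open>
  The closed sets \<open>E n\<close> of points at which the family is bounded by \<open>n\<close> cover the space, so by
  Baire's theorem one of them contains a ball around some \<open>a\<close>. Subtracting the values at \<open>a\<close>
  moves the bound to a ball around the origin, from where it spreads by homogeneity.
\<close>

theorem uniform_boundedness:
  fixes F :: "('a::banach \<Rightarrow> 'b::real_normed_vector) set"
  assumes lin: "\<And>f. f \<in> F \<Longrightarrow> bounded_linear f"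
    and ptwise: "\<And>x. \<exists>K. \<forall>f\<in>F. norm (f x) \<le> K"
  shows "\<exists>K. \<forall>f\<in>F. \<forall>x. norm (f x) \<le> K * norm x"
proof -
  define E where "E n = (\<Inter>f\<in>F. {x. norm (f x) \<le> real n})" for n
  have closed_E: "closed (E n)" for n
    unfolding E_def
    by (intro closed_INT ballI closed_Collect_le continuous_on_norm continuous_on_const
        linear_continuous_on[OF lin])
  have "x \<in> \<Union>(range E)" for x
  proof -
    obtain K where "\<forall>f\<in>F. norm (f x) \<le> K" using ptwise by blast
    then show ?thesis
      using real_arch_simple[of K] by (auto simp: E_def intro: order_trans)
  qed
  then have cover: "\<Union>(range E) = UNIV" by blast
  have "\<exists>n. interior (E n) \<noteq> {}"
  proof (rule ccontr)
    assume "\<not> ?thesis"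
    then have "interior (\<Union>(range E)) = {}"
      using Met_TC.metric_Baire_category_alt[of "range E"] closed_E
      by (auto simp: complete_UNIV)
    then show False by (simp add: cover)
  qed
  then obtain n a where "a \<in> interior (E n)" by blast
  then obtain r where r: "r > 0" "cball a r \<subseteq> E n"
    unfolding mem_interior_cball by blast
  have "norm (f x) \<le> (2 * real n / r) * norm x" if "f \<in> F" for f x
  proof (cases "x = 0")
    case True
    then show ?thesis using lin[OF that] by (simp add: bounded_linear.linear linear_0)
  next
    case False
    interpret f: bounded_linear f using that by (rule lin)
    define u where "u = (r / norm x) *\<^sub>R x"
    have "norm u = r" using False r(1) by (simp add: u_def)
    then have "a + u \<in> E n" "a \<in> E n" using r by (auto simp: dist_norm subset_iff)
    then have "norm (f (a + u)) \<le> real n" "norm (f a) \<le> real n"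
      using that by (auto simp: E_def)
    then have "norm (f u) \<le> 2 * real n"
      using norm_triangle_ineq4[of "f (a + u)" "f a"] by (simp add: f.add)
    moreover have "norm (f u) = r / norm x * norm (f x)"
      using r(1) by (simp add: u_def f.scale)
    ultimately show ?thesis
      using r(1) False by (simp add: field_simps)
  qed
  then show ?thesis by blast
qed

section \<open>The real inner product of a quaternionic Hilbert space\<close>

text \<open>The four coordinates of \<open>p\<close> are, up to sign, the real parts of its products with the basis.\<close>

lemma quat_eqI_QRe_mult:
  assumes "\<And>q. QRe (p * q) = QRe (p' * q)"
  shows "p = p'"
  using assms[of "Quat 1 0 0 0"] assms[of "Quat 0 1 0 0"] assms[of "Quat 0 0 1 0"]
    assms[of "Quat 0 0 0 1"]
  by (simp add: quat_eq_iff)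

definition re_inner :: "'v::right_quat_hilbert \<Rightarrow> 'v \<Rightarrow> real" where
  "re_inner x y = QRe (qinner x y)"

lemma re_inner_commute: "re_inner x y = re_inner y x"
  unfolding re_inner_def by (metis qcnj.sel(1) qcnj_qinner)

lemma re_inner_self: "re_inner x x = (norm x)\<^sup>2"
  by (simp add: re_inner_def qinner_self of_real_def)

lemma re_inner_add_right: "re_inner x (y + z) = re_inner x y + re_inner x z"
  by (simp add: re_inner_def qinner_add_right)

lemma re_inner_add_left: "re_inner (x + y) z = re_inner x z + re_inner y z"
  by (metis re_inner_commute re_inner_add_right)

lemma re_inner_scaleR_right: "re_inner x (r *\<^sub>R y) = r * re_inner x y"
  unfolding re_inner_def scaleQ_of_real[symmetric] qinner_scaleQ_right
  by (simp add: of_real_def)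

lemma re_inner_scaleR_left: "re_inner (r *\<^sub>R x) y = r * re_inner x y"
  by (metis re_inner_commute re_inner_scaleR_right)

text \<open>
  Since the norm is already known to satisfy the triangle inequality, Cauchy--Schwarz follows
  by squaring it.
\<close>

lemma abs_re_inner_le: "\<bar>re_inner x y\<bar> \<le> norm x * norm y"
proof -
  have *: "re_inner x y \<le> norm x * norm y" for x y :: 'a
  proof -
    have "(norm (x + y))\<^sup>2 = (norm x)\<^sup>2 + (norm y)\<^sup>2 + 2 * re_inner x y"
      unfolding re_inner_self[symmetric]
      by (simp add: re_inner_add_left re_inner_add_right re_inner_commute)
    moreover have "(norm (x + y))\<^sup>2 \<le> (norm x + norm y)\<^sup>2"
      by (intro power_mono norm_triangle_ineq norm_ge_zero)
    ultimately show ?thesis by (simp add: power2_sum)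
  qed
  have "re_inner x (- y) = - re_inner x y"
    using re_inner_scaleR_right[of x "-1" y] by simp
  with *[of x y] *[of x "- y"] show ?thesis by simp
qed

lemma bounded_bilinear_re_inner: "bounded_bilinear re_inner"
  by (rule bounded_bilinear.intro)
     (auto simp: re_inner_add_left re_inner_add_right re_inner_scaleR_left re_inner_scaleR_right
        intro!: exI[of _ 1] abs_re_inner_le)

interpretation re_inner: bounded_bilinear re_inner
  by (rule bounded_bilinear_re_inner)

lemma re_inner_eqI:
  assumes "\<And>x. re_inner y x = re_inner z x"
  shows "y = z"
proof -
  have "(norm (y - z))\<^sup>2 = 0"
    unfolding re_inner_self[symmetric] by (simp add: re_inner.diff_left assms)
  then show ?thesis by simp
qed

lemma Riesz_representation:
  fixes f :: "'v::right_quat_hilbert \<Rightarrow> real"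
  assumes "bounded_linear f"
  shows "\<exists>z. \<forall>x. re_inner z x = f x"
proof -
  have "\<exists>z\<in>UNIV. \<forall>x\<in>UNIV. re_inner z x = f x"
    by (rule symmetric_Lax_Milgram_on_subspace[OF bounded_bilinear_re_inner re_inner_commute
          zero_less_one _ assms subspace_UNIV closed_UNIV])
      (simp add: re_inner_self)
  then show ?thesis by simp
qed

section \<open>The adjoint\<close>

lemma bounded_opsD:
  assumes "A \<in> bounded_ops"
  shows "bounded_linear A" "A (x *\<^sub>Q q) = A x *\<^sub>Q q"
  using assms by (auto simp: bounded_ops_def)

text \<open>
  Replacing \<open>x\<close> by \<open>x q\<close> multiplies both quaternionic inner products by \<open>q\<close> on the right, so that
  equality of the real parts for all \<open>x\<close> already determines all four coordinates.
\<close>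

lemma qinner_adjointI:
  assumes "A \<in> bounded_ops" and "\<And>y x. re_inner y (A x) = re_inner (B y) x"
  shows "qinner y (A x) = qinner (B y) x"
proof (rule quat_eqI_QRe_mult)
  fix q
  show "QRe (qinner y (A x) * q) = QRe (qinner (B y) x * q)"
    using assms(2)[of y "x *\<^sub>Q q"] bounded_opsD(2)[OF assms(1)]
    by (simp add: re_inner_def flip: qinner_scaleQ_right)
qed

text \<open>
  Riesz representation yields \<open>B\<close> pointwise; its linearity, right linearity and boundedness are
  forced by the defining identity and nondegeneracy.
\<close>

lemma adjoint_exists:
  assumes A: "A \<in> bounded_ops"
  shows "\<exists>B\<in>bounded_ops. \<forall>y x. qinner y (A x) = qinner (B y) x"
proof -
  have lin: "bounded_linear A" using A by (rule bounded_opsD)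
  have "\<exists>z. \<forall>x. re_inner z x = re_inner y (A x)" for y
    by (rule Riesz_representation[OF bounded_linear_compose[OF re_inner.bounded_linear_right lin]])
  then obtain B where B: "\<And>y x. re_inner (B y) x = re_inner y (A x)"
    by metis
  have qB: "qinner y (A x) = qinner (B y) x" for x y
    using A B by (intro qinner_adjointI) simp_all
  have "bounded_linear B"
  proof (rule bounded_linear_intro)
    show "B (x + y) = B x + B y" for x y
      by (rule re_inner_eqI) (simp add: B re_inner_add_left)
    show "B (r *\<^sub>R x) = r *\<^sub>R B x" for r x
      by (rule re_inner_eqI) (simp add: B re_inner_scaleR_left)
    show "norm (B y) \<le> norm y * onorm A" for y
    proof (cases "B y = 0")
      case False
      have "norm (B y) * norm (B y) = re_inner y (A (B y))"
        using re_inner_self[of "B y"] B by (simp add: power2_eq_square)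
      also have "\<dots> \<le> norm y * norm (A (B y))"
        using abs_re_inner_le[of y "A (B y)"] by linarith
      also have "\<dots> \<le> norm y * (onorm A * norm (B y))"
        by (intro mult_left_mono onorm lin norm_ge_zero)
      finally show ?thesis using False by (simp flip: mult.assoc)
    qed (simp add: onorm_pos_le[OF lin])
  qed
  moreover have "B (y *\<^sub>Q q) = B y *\<^sub>Q q" for y q
    by (rule re_inner_eqI) (simp add: re_inner_def qinner_scaleQ_left flip: qB)
  ultimately show ?thesis using qB by (auto simp: bounded_ops_def)
qed

lemma qadjoint_eqI:
  assumes "B \<in> bounded_ops" "\<And>y x. qinner y (A x) = qinner (B y) x"
  shows "qadjoint A = B"
  unfolding qadjoint_def
proof (rule the_equality)
  fix C assume C: "C \<in> bounded_ops \<and> (\<forall>y x. qinner y (A x) = qinner (C y) x)"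
  show "C = B"
  proof
    show "C y = B y" for y
      by (rule re_inner_eqI) (metis re_inner_def C assms(2))
  qed
qed (use assms in blast)

lemma
  assumes "A \<in> bounded_ops"
  shows qadjoint_in_bounded_ops: "qadjoint A \<in> bounded_ops"
    and qinner_qadjoint: "qinner y (A x) = qinner (qadjoint A y) x"
proof -
  obtain B where B: "B \<in> bounded_ops" "\<And>y x. qinner y (A x) = qinner (B y) x"
    using adjoint_exists[OF assms] by blast
  moreover from this have "qadjoint A = B" by (rule qadjoint_eqI)
  ultimately show "qadjoint A \<in> bounded_ops" "qinner y (A x) = qinner (qadjoint A y) x"
    by simp_all
qed

lemma re_inner_qadjoint:
  "A \<in> bounded_ops \<Longrightarrow> re_inner y (A x) = re_inner (qadjoint A y) x"
  by (simp add: re_inner_def qinner_qadjoint)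

lemma qadjoint_qadjoint:
  assumes "A \<in> bounded_ops"
  shows "qadjoint (qadjoint A) = A"
proof (rule qadjoint_eqI[OF assms])
  show "qinner y (qadjoint A x) = qinner (A y) x" for y x
    by (metis qcnj_qinner qinner_qadjoint[OF assms])
qed

lemma qadjoint_left_inverse:
  assumes "T \<in> bounded_ops" "B \<in> bounded_ops" "B \<circ> T = id"
  shows "qadjoint T \<circ> qadjoint B = id"
proof
  fix y
  have "re_inner ((qadjoint T \<circ> qadjoint B) y) x = re_inner (id y) x" for x
    using fun_cong[OF assms(3), of x] assms(1,2) by (simp flip: re_inner_qadjoint)
  then show "(qadjoint T \<circ> qadjoint B) y = id y" by (rule re_inner_eqI)
qed

section \<open>Duality between an operator and its adjoint\<close>

lemma subspace_closure:
  fixes S :: "'a::real_normed_vector set"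
  assumes "subspace S"
  shows "subspace (closure S)"
proof (rule subspaceI)
  show "0 \<in> closure S"
    using subspace_0[OF assms] closure_subset by blast
next
  fix x y assume "x \<in> closure S" "y \<in> closure S"
  then obtain X Y where "\<And>n. X n \<in> S" "X \<longlonglongrightarrow> x" "\<And>n. Y n \<in> S" "Y \<longlonglongrightarrow> y"
    unfolding closure_sequential by metis
  then show "x + y \<in> closure S"
    unfolding closure_sequential
    by (intro exI[of _ "\<lambda>n. X n + Y n"]) (simp add: tendsto_add subspace_add[OF assms])
next
  fix c x assume "x \<in> closure S"
  then obtain X where "\<And>n. X n \<in> S" "X \<longlonglongrightarrow> x"
    unfolding closure_sequential by metis
  then show "c *\<^sub>R x \<in> closure S"
    unfolding closure_sequential
    by (intro exI[of _ "\<lambda>n. c *\<^sub>R X n"]) (simp add: tendsto_scaleR subspace_scale[OF assms])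
qed

text \<open>
  The kernel of the adjoint is the orthogonal complement of the range. If it is trivial, every
  vector coincides with its projection onto the closure of the range; if the range is dense, a vector
  orthogonal to it is orthogonal to itself.
\<close>

lemma qadjoint_kernel_trivial_iff_dense_range:
  assumes T: "T \<in> bounded_ops"
  shows "{y. qadjoint T y = 0} = {0} \<longleftrightarrow> closure (range T) = UNIV"
proof
  assume ker: "{y. qadjoint T y = 0} = {0}"
  let ?S = "closure (range T)"
  have S: "subspace ?S" "closed ?S"
    using linear_subspace_image[OF bounded_linear.linear[OF bounded_opsD(1)[OF T]] subspace_UNIV]
    by (simp_all add: subspace_closure)
  show "?S = UNIV"
  proof (intro equalityI subset_UNIV subsetI)
    fix w :: 'a
    \<comment> \<open>\<open>z\<close> is the orthogonal projection of \<open>w\<close> onto \<open>?S\<close>.\<close>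
    have "\<exists>z\<in>?S. \<forall>x\<in>?S. re_inner z x = re_inner w x"
      by (rule symmetric_Lax_Milgram_on_subspace[OF bounded_bilinear_re_inner re_inner_commute
            zero_less_one _ re_inner.bounded_linear_right S])
        (simp add: re_inner_self)
    then obtain z where z: "z \<in> ?S" "\<And>x. x \<in> ?S \<Longrightarrow> re_inner z x = re_inner w x"
      by blast
    have "re_inner (qadjoint T (w - z)) x = re_inner 0 x" for x
      using z(2)[OF subsetD[OF closure_subset rangeI], of x]
      by (simp add: re_inner.diff_left re_inner.zero_left flip: re_inner_qadjoint[OF T])
    then have "qadjoint T (w - z) = 0" by (rule re_inner_eqI)
    then have "w - z \<in> {y. qadjoint T y = 0}" by simp
    then have "w = z" unfolding ker by simp
    with z(1) show "w \<in> ?S" by simp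
  qed
next
  assume dense: "closure (range T) = UNIV"
  have "y = 0" if "qadjoint T y = 0" for y
  proof -
    have "closed {x. re_inner y x = 0}"
      by (intro closed_Collect_eq linear_continuous_on re_inner.bounded_linear_right
          continuous_on_const)
    moreover have "range T \<subseteq> {x. re_inner y x = 0}"
      by (auto simp: re_inner_qadjoint[OF T] that re_inner.zero_left)
    ultimately have "closure (range T) \<subseteq> {x. re_inner y x = 0}"
      by (rule closure_minimal[rotated])
    then have "re_inner y y = 0" using dense by blast
    then show ?thesis by (simp add: re_inner_self)
  qed
  moreover have "qadjoint T 0 = 0"
    using bounded_opsD(1)[OF qadjoint_in_bounded_ops[OF T]]
    by (simp add: bounded_linear.linear linear_0)
  ultimately show "{y. qadjoint T y = 0} = {0}" by blast
qed

definition bounded_below :: "('a::real_normed_vector \<Rightarrow> 'b::real_normed_vector) \<Rightarrow> bool" where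
  "bounded_below T \<longleftrightarrow> (\<exists>c>0. \<forall>x. c * norm x \<le> norm (T x))"

text \<open>
  If \<open>T\<close> is bounded below, the form \<open>\<langle>Tx, Ty\<rangle>\<close> is coercive. Representing the functional \<open>\<langle>w, -\<rangle>\<close> by
  it solves the normal equation \<open>T\<^sup>* T z = w\<close>, so \<open>w\<close> is in the range of \<open>T\<^sup>*\<close>.
\<close>

lemma bounded_below_imp_qadjoint_surj:
  assumes T: "T \<in> bounded_ops" and "bounded_below T"
  shows "surj (qadjoint T)"
proof -
  obtain c where c: "c > 0" "\<And>x. c * norm x \<le> norm (T x)"
    using assms(2) by (auto simp: bounded_below_def)
  have lin: "bounded_linear T" using T by (rule bounded_opsD)
  have "\<exists>z. w = qadjoint T z" for w
  proof -
    have coercive: "c\<^sup>2 * (norm x)\<^sup>2 \<le> re_inner (T x) (T x)" for x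
      using power_mono[OF c(2)[of x], of 2] c(1) by (simp add: re_inner_self power_mult_distrib)
    have "\<exists>z\<in>UNIV. \<forall>x\<in>UNIV. re_inner (T z) (T x) = re_inner w x"
      by (rule symmetric_Lax_Milgram_on_subspace[OF
            bounded_bilinear.comp[OF bounded_bilinear_re_inner lin lin] re_inner_commute
            zero_less_power[OF c(1)] coercive re_inner.bounded_linear_right
            subspace_UNIV closed_UNIV])
    then obtain z where "\<And>x. re_inner (qadjoint T (T z)) x = re_inner w x"
      by (auto simp: re_inner_qadjoint[OF T])
    then have "qadjoint T (T z) = w" by (rule re_inner_eqI)
    then show ?thesis by blast
  qed
  then show ?thesis by (auto simp: surj_def)
qed

text \<open>
  On the vectors \<open>y\<close> with \<open>\<parallel>T\<^sup>* y\<parallel> \<le> 1\<close> the functionals \<open>\<langle>y, -\<rangle>\<close> are pointwise bounded: every point is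
  some \<open>T u\<close>, and \<open>\<langle>y, T u\<rangle> = \<langle>T\<^sup>* y, u\<rangle>\<close> is at most \<open>\<parallel>u\<parallel>\<close>. By uniform boundedness these \<open>y\<close> form
  a bounded set, which by homogeneity is a lower bound for \<open>T\<^sup>*\<close>.
\<close>

lemma surj_imp_qadjoint_bounded_below:
  assumes T: "T \<in> bounded_ops" and "surj T"
  shows "bounded_below (qadjoint T)"
proof -
  let ?T' = "qadjoint T"
  let ?F = "re_inner ` {y. norm (?T' y) \<le> 1}"
  have "\<exists>K. \<forall>f\<in>?F. \<forall>x. norm (f x) \<le> K * norm x"
  proof (rule uniform_boundedness)
    fix x
    obtain u where u: "x = T u" using \<open>surj T\<close> by (auto simp: surj_def)
    have "norm (re_inner y x) \<le> norm u" if "norm (?T' y) \<le> 1" for y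
    proof -
      have "norm (re_inner y x) \<le> norm (?T' y) * norm u"
        by (simp add: u re_inner_qadjoint[OF T] abs_re_inner_le)
      also have "\<dots> \<le> 1 * norm u" using that by (intro mult_right_mono) auto
      finally show ?thesis by simp
    qed
    then show "\<exists>K. \<forall>f\<in>?F. norm (f x) \<le> K" by blast
  qed (auto simp: re_inner.bounded_linear_right)
  then obtain K where K: "\<And>y x. norm (?T' y) \<le> 1 \<Longrightarrow> \<bar>re_inner y x\<bar> \<le> K * norm x"
    by auto
  have le_K: "norm y \<le> K" if "norm (?T' y) \<le> 1" "y \<noteq> 0" for y
    using K[OF that(1), of y] that(2) by (simp add: re_inner_self power2_eq_square)
  interpret T': bounded_linear ?T'
    using T by (intro bounded_opsD(1) qadjoint_in_bounded_ops)
  \<comment> \<open>\<open>\<bar>K\<bar> + 1\<close> replaces \<open>K\<close> because \<open>K\<close> need not be positive, for instance on the zero space.\<close>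
  have "inverse (\<bar>K\<bar> + 1) * norm y \<le> norm (?T' y)" for y
  proof (cases "y = 0")
    case False
    \<comment> \<open>Otherwise every nonzero multiple of \<open>y\<close> would have norm at most \<open>K\<close>.\<close>
    have "?T' y \<noteq> 0"
    proof
      assume "?T' y = 0"
      then have "norm (((\<bar>K\<bar> + 1) / norm y) *\<^sub>R y) \<le> K"
        using False by (intro le_K) (auto simp: T'.scale)
      then show False using False by simp
    qed
    then have "norm ((1 / norm (?T' y)) *\<^sub>R y) \<le> K"
      using False by (intro le_K) (auto simp: T'.scale)
    then have "norm y \<le> K * norm (?T' y)"
      using \<open>?T' y \<noteq> 0\<close> by (simp add: field_simps)
    also have "\<dots> \<le> (\<bar>K\<bar> + 1) * norm (?T' y)"
      by (intro mult_right_mono) auto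
    finally show ?thesis by (simp add: field_simps)
  qed (simp add: T'.zero)
  then show ?thesis
    unfolding bounded_below_def by (intro exI[of _ "inverse (\<bar>K\<bar> + 1)"]) auto
qed

lemma surj_iff_qadjoint_bounded_below:
  assumes "T \<in> bounded_ops"
  shows "surj T \<longleftrightarrow> bounded_below (qadjoint T)"
  using assms surj_imp_qadjoint_bounded_below bounded_below_imp_qadjoint_surj
    qadjoint_in_bounded_ops qadjoint_qadjoint by metis

lemma bounded_below_iff_no_null_sequence:
  assumes "bounded_linear T"
  shows "bounded_below T \<longleftrightarrow>
    \<not> (\<exists>x::nat \<Rightarrow> _. (\<forall>n. norm (x n) = 1) \<and> (\<lambda>n. norm (T (x n))) \<longlonglongrightarrow> 0)"
proof (intro iffI notI)
  assume "bounded_below T"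
  then obtain c where c: "c > 0" "\<And>x. c * norm x \<le> norm (T x)"
    by (auto simp: bounded_below_def)
  assume "\<exists>x::nat \<Rightarrow> _. (\<forall>n. norm (x n) = 1) \<and> (\<lambda>n. norm (T (x n))) \<longlonglongrightarrow> 0"
  then obtain x :: "nat \<Rightarrow> _" where x: "\<And>n. norm (x n) = 1" "(\<lambda>n. norm (T (x n))) \<longlonglongrightarrow> 0"
    by blast
  have "c \<le> 0"
    using x(2) by (rule LIMSEQ_le_const) (metis c(2) x(1) mult.right_neutral)
  with c(1) show False by simp
next
  assume *: "\<not> (\<exists>x::nat \<Rightarrow> _. (\<forall>n. norm (x n) = 1) \<and> (\<lambda>n. norm (T (x n))) \<longlonglongrightarrow> 0)"
  interpret T: bounded_linear T by fact
  show "bounded_below T"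
  proof (rule ccontr)
    assume "\<not> bounded_below T"
    then have "\<exists>y. norm (T y) < inverse (real (Suc n)) * norm y" for n
      unfolding bounded_below_def
      by (metis inverse_positive_iff_positive not_le of_nat_0_less_iff zero_less_Suc)
    then obtain y where y: "\<And>n. norm (T (y n)) < inverse (real (Suc n)) * norm (y n)"
      by metis
    have nz: "y n \<noteq> 0" for n
      using y[of n] by auto
    let ?x = "\<lambda>n. (1 / norm (y n)) *\<^sub>R y n"
    have "norm (T (?x n)) \<le> inverse (real (Suc n))" for n
      using y[of n] nz[of n]
      by (simp add: T.scale field_simps less_imp_le del: of_nat_Suc)
    then have "(\<lambda>n. norm (T (?x n))) \<longlonglongrightarrow> 0"
      by (intro real_tendsto_sandwich[OF _ _ tendsto_const LIMSEQ_inverse_real_of_nat])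
        (auto simp del: of_nat_Suc)
    moreover have "\<forall>n. norm (?x n) = 1" using nz by simp
    ultimately have "\<exists>x::nat \<Rightarrow> _. (\<forall>n. norm (x n) = 1) \<and> (\<lambda>n. norm (T (x n))) \<longlonglongrightarrow> 0"
      by (intro exI[of _ ?x] conjI)
    with * show False ..
  qed
qed

section \<open>The S-spectra of an operator and of its adjoint\<close>

lemma R_op_in_bounded_ops:
  assumes "A \<in> bounded_ops"
  shows "R_op q A \<in> bounded_ops"
proof -
  have lin: "bounded_linear A" using assms by (rule bounded_opsD)
  have scale: "(r *\<^sub>R x) *\<^sub>Q p = r *\<^sub>R (x *\<^sub>Q p)" for r and x :: 'a and p
    unfolding scaleQ_of_real[symmetric] scaleQ_scaleQ
    by (simp add: of_real_def)
  have diff: "(x - y) *\<^sub>Q p = x *\<^sub>Q p - y *\<^sub>Q p" for x y :: 'a and p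
    using scaleQ_add_left[of "x - y" y p] by (simp add: algebra_simps)
  have "bounded_linear (R_op q A)"
    unfolding R_op_def
    by (intro bounded_linear_add bounded_linear_sub bounded_linear_const_scaleR
        bounded_linear_compose[OF lin lin] lin bounded_linear_ident)
  then show ?thesis
    by (simp add: bounded_ops_def R_op_def bounded_opsD(2)[OF assms] scale diff scaleQ_add_left)
qed

text \<open>The coefficients of the polynomial defining \<open>R_op\<close> are real, hence unchanged by the adjoint.\<close>

lemma qadjoint_R_op:
  assumes A: "A \<in> bounded_ops"
  shows "qadjoint (R_op q A) = R_op q (qadjoint A)"
proof (rule qadjoint_eqI)
  show "R_op q (qadjoint A) \<in> bounded_ops"
    using A by (intro R_op_in_bounded_ops qadjoint_in_bounded_ops)
  show "qinner y (R_op q A x) = qinner (R_op q (qadjoint A) y) x" for y x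
    by (rule qinner_adjointI[OF R_op_in_bounded_ops[OF A]])
      (simp add: R_op_def re_inner.add_right re_inner.add_left re_inner.diff_right
        re_inner.diff_left re_inner.scaleR_right re_inner.scaleR_left re_inner_qadjoint[OF A])
qed

lemma S_compression_spectrum_eq_point_spectrum_qadjoint:
  assumes "A \<in> bounded_ops"
  shows "S_compression_spectrum A = S_point_spectrum (qadjoint A)"
  using qadjoint_kernel_trivial_iff_dense_range[OF R_op_in_bounded_ops[OF assms]]
  by (simp add: S_compression_spectrum_def S_point_spectrum_def qadjoint_R_op[OF assms])

lemma S_surjectivity_spectrum_eq_approx_spectrum_qadjoint:
  assumes "A \<in> bounded_ops"
  shows "S_surjectivity_spectrum A = S_approx_spectrum (qadjoint A)"
proof -
  have "surj (R_op q A) \<longleftrightarrow> q \<notin> S_approx_spectrum (qadjoint A)" for q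
    using surj_iff_qadjoint_bounded_below[OF R_op_in_bounded_ops[OF assms], of q]
      bounded_below_iff_no_null_sequence[OF bounded_opsD(1)[OF R_op_in_bounded_ops[OF
            qadjoint_in_bounded_ops[OF assms]]], of q]
    by (simp add: S_approx_spectrum_def qadjoint_R_op[OF assms])
  then show ?thesis by (auto simp: S_surjectivity_spectrum_def)
qed

lemma S_spectrum_qadjoint_subset:
  assumes A: "A \<in> bounded_ops"
  shows "S_spectrum (qadjoint A) \<subseteq> S_spectrum A"
proof
  fix q assume q: "q \<in> S_spectrum (qadjoint A)"
  note R = R_op_in_bounded_ops[OF A, of q]
  show "q \<in> S_spectrum A"
  proof (rule ccontr)
    assume "q \<notin> S_spectrum A"
    then obtain B where B: "B \<in> bounded_ops" "B \<circ> R_op q A = id" "R_op q A \<circ> B = id"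
      by (auto simp: S_spectrum_def)
    have "qadjoint B \<circ> R_op q (qadjoint A) = id" "R_op q (qadjoint A) \<circ> qadjoint B = id"
      using qadjoint_left_inverse[OF R B(1,2)] qadjoint_left_inverse[OF B(1) R B(3)]
      by (simp_all add: qadjoint_R_op[OF A])
    with q qadjoint_in_bounded_ops[OF B(1)] show False
      by (auto simp: S_spectrum_def)
  qed
qed

theorem proposition4p10:
  fixes A :: "'v::right_quat_hilbert \<Rightarrow> 'v"
  assumes "A \<in> bounded_ops"
  shows "(S_point_spectrum A \<subseteq> S_compression_spectrum (qadjoint A) \<and>
          S_compression_spectrum A = S_point_spectrum (qadjoint A)) \<and>
         (S_surjectivity_spectrum A = S_approx_spectrum (qadjoint A) \<and>
          S_approx_spectrum A = S_surjectivity_spectrum (qadjoint A)) \<and>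
         S_spectrum A = S_spectrum (qadjoint A)"
  using S_compression_spectrum_eq_point_spectrum_qadjoint
    S_surjectivity_spectrum_eq_approx_spectrum_qadjoint S_spectrum_qadjoint_subset
    qadjoint_in_bounded_ops[OF assms] qadjoint_qadjoint[OF assms] assms
  by (metis order_refl subset_antisym)

end
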